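(* Let $p\ge 2$ be an integer and let $S$ be a nontrivial finite subtree of $T_p$ which is rooted at $\epsilon$. The following properties are equivalent: (1) $S$ is a tile in some tiling $(S,\Omega)$ of $T_p$. (2) $S$ is full, i.e. all $p$ child nodes (in $T_p$) of any non-leaf node of $S$ belong to $S$. (3) $S$ is leaf-comparable, i.e. for any word $w\in\Sigma_p^*$ there is a leaf $\ell\in L(S)$ such that either $\ell\le w$ or $w\le \ell$. (4) Any word $w\in\Sigma_p^*$ has a unique factorization $w=\ell_1\cdots\ell_n s$, where $n\ge 0$, $\ell_1,\dots,\ell_n$ are (not necessarily distinct) leaves of $S$, and $s\in V(S)\setminus L(S)$ is a non-leaf node of $S$ (uniqueness means that $n$, the sequence $(\ell_1,\dots,\ell_n)$ and $s$ are all determined by $w$). Moreover, if these properties hold, then $\Omega$ may be chosen to be the submonoid $\Lambda$ of $\Sigma_p^*$ generated by $L(S)$, that is, $(S,\Lambda)$ is a tiling of $T_p$.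
   Context: $\Sigma_p=\{0,1,\dots,p-1\}$ and $\Sigma_p^*$ is the monoid of finite words over $\Sigma_p$ under concatenation, with identity the empty word $\epsilon$. For words $v,w$ write $v\le w$ if $v$ is a prefix of $w$, i.e. $w=vw'$ for some word $w'$. The full infinite $p$-ary rooted tree $T_p$ has vertex set $V(T_p)=\Sigma_p^*$, root $\epsilon$, and edges $(w,wc)$ for $w\in\Sigma_p^*$, $c\in\Sigma_p$; the children of $w$ are the words $wc$. A subtree $S$ of $T_p$ is a connected subgraph, with vertex set $V(S)$ and edge set $E(S)$; it is nontrivial if $E(S)\ne\varnothing$, and rooted at $\epsilon$ if $\epsilon\in V(S)$. $L(S)$ denotes the set of leaves of $S$, i.e. nodes of $S$ having no children in $S$. $\Sigma_p^*$ acts on $T_p$ by left translation: $\omega\cdot v=\omega v$ on vertices and $\omega(v,v')=(\omega v,\omega v')$ on edges; $\omega S$ is the translate of $S$. A tiling of $T_p$ is a pair $(S,\Omega)$ where $S$ (the tile) is a nontrivial finite subtree of $T_p$ and $\Omega\subseteq\Sigma_p^*$ is a subset such that $T_p$ is the almost disjoint union of the translates $\omega S$, $\omega\in\Omega$: every vertex of $T_p$ is of the form $\omega s$ with $\omega\in\Omega$, $s\in V(S)$; every edge of $T_p$ is of the form $\omega e$ with $\omega\in\Omega$, $e\in E(S)$; and for distinct $\omega,\omega'\in\Omega$ the subgraphs $\omega S$ and $\omega' S$ have no common edge. *)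

theory Defs
  imports "Graph_Theory.Digraph_Component" "HOL-Library.Sublist"
begin

definition words :: "nat \<Rightarrow> nat list set" where
  "words p = lists {..<p}"

definition children :: "nat \<Rightarrow> nat list \<Rightarrow> nat list set" where
  "children p w = {w @ [c] | c. c < p}"

text \<open>Edges are represented as pairs (parent, child).\<close>

definition full_tree :: "nat \<Rightarrow> nat list pair_pre_digraph" where
  "full_tree p = \<lparr> pverts = words p, parcs = {(w, w'). w \<in> words p \<and> w' \<in> children p w} \<rparr>"

text \<open>Connectedness of a digraph in the sense of \<^theory>\<open>Graph_Theory.Digraph_Component\<close> is
  connectedness of the underlying undirected graph; it includes that there is at least one vertex.\<close>

definition subtree :: "nat \<Rightarrow> nat list pair_pre_digraph \<Rightarrow> bool" where
  "subtree p S \<longleftrightarrow>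
     subgraph (with_proj S) (with_proj (full_tree p)) \<and> Digraph_Component.connected (with_proj S)"

definition nontrivial_finite_subtree :: "nat \<Rightarrow> nat list pair_pre_digraph \<Rightarrow> bool" where
  "nontrivial_finite_subtree p S \<longleftrightarrow>
     subtree p S \<and> finite (pverts S) \<and> finite (parcs S) \<and> parcs S \<noteq> {}"

definition leaves :: "nat \<Rightarrow> nat list pair_pre_digraph \<Rightarrow> nat list set" where
  "leaves p S = {v \<in> pverts S. children p v \<inter> pverts S = {}}"

definition translate :: "nat list \<Rightarrow> nat list pair_pre_digraph \<Rightarrow> nat list pair_pre_digraph" where
  "translate \<omega> S = \<lparr> pverts = (\<lambda>v. \<omega> @ v) ` pverts S,
                    parcs = (\<lambda>(v, v'). (\<omega> @ v, \<omega> @ v')) ` parcs S \<rparr>"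

definition tiling :: "nat \<Rightarrow> nat list pair_pre_digraph \<Rightarrow> nat list set \<Rightarrow> bool" where
  "tiling p S \<Omega> \<longleftrightarrow>
     nontrivial_finite_subtree p S \<and> \<Omega> \<subseteq> words p \<and>
     (\<forall>w \<in> pverts (full_tree p). \<exists>\<omega>\<in>\<Omega>. w \<in> pverts (translate \<omega> S)) \<and>
     (\<forall>e \<in> parcs (full_tree p). \<exists>\<omega>\<in>\<Omega>. e \<in> parcs (translate \<omega> S)) \<and>
     (\<forall>\<omega>\<in>\<Omega>. \<forall>\<omega>'\<in>\<Omega>. \<omega> \<noteq> \<omega>' \<longrightarrow>
        parcs (translate \<omega> S) \<inter> parcs (translate \<omega>' S) = {})"

definition full :: "nat \<Rightarrow> nat list pair_pre_digraph \<Rightarrow> bool" where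
  "full p S \<longleftrightarrow> (\<forall>v \<in> pverts S - leaves p S. children p v \<subseteq> pverts S)"

definition leaf_comparable :: "nat \<Rightarrow> nat list pair_pre_digraph \<Rightarrow> bool" where
  "leaf_comparable p S \<longleftrightarrow> (\<forall>w \<in> words p. \<exists>l \<in> leaves p S. prefix l w \<or> prefix w l)"

definition unique_factorization :: "nat \<Rightarrow> nat list pair_pre_digraph \<Rightarrow> bool" where
  "unique_factorization p S \<longleftrightarrow>
     (\<forall>w \<in> words p. \<exists>!x. case x of (ls, s) \<Rightarrow>
        ls \<in> lists (leaves p S) \<and> s \<in> pverts S - leaves p S \<and> w = concat ls @ s)"

inductive_set generated_submonoid :: "'a list set \<Rightarrow> 'a list set" for A where
  one: "[] \<in> generated_submonoid A"
| incl: "a \<in> A \<Longrightarrow> a \<in> generated_submonoid A"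
| mult: "u \<in> generated_submonoid A \<Longrightarrow> v \<in> generated_submonoid A \<Longrightarrow> u @ v \<in> generated_submonoid A"

end

theory Submission
  imports Defs
begin

text \<open>
  Connectedness of \<open>S\<close> enters only through one consequence: a vertex other than the root is
  joined in \<open>S\<close> to its parent in \<open>T\<^sub>p\<close> (\<open>arc_from_parent\<close>). So \<open>S\<close> is
  determined by its vertices, a finite prefix-closed set of words, and a leaf is a vertex that is
  not a proper prefix of another one. In particular the leaves form a prefix code, and no leaf is
  a prefix of a non-leaf vertex. Reading a product \<open>l\<^sub>1 \<dots> l\<^sub>n s\<close> from the left, each
  leaf factor is therefore forced, which is why such factorizations are always unique
  (\<open>factorization_unique\<close>). Fullness decides only whether they exist.

  In a full tree the descent along any word can stop only at a leaf or at the end of the word,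
  and this is leaf-comparability. Conversely, if a child \<open>v d\<close> of a non-leaf vertex were missing
  from \<open>S\<close>, then \<open>v d\<close> would be comparable with no leaf. Leaf-comparability lets one strip
  leaves off the front of a word until a non-leaf vertex remains, and so gives factorizations.

  Given unique factorizations and fullness, the submonoid generated by the leaves tiles: an edge
  of \<open>\<omega> S\<close> starts at \<open>\<omega> s\<close> with \<open>s\<close> a non-leaf vertex, and factoring the word
  \<open>\<omega> s\<close> recovers \<open>\<omega>\<close>.

  The implication from tilings to fullness (\<open>tiling_imp_full\<close>) is the one that needs an idea.
  The edges at the root of \<open>T\<^sub>p\<close> can be covered only by the tile with \<open>\<omega>\<close> empty, hence
  the root of \<open>S\<close> is full. If \<open>v\<close> is a non-leaf vertex that lacks a child, every translate
  \<open>\<omega> v\<close> carries edges of a second tile. Two tiles cannot both contain the edge that enters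
  \<open>\<omega> v\<close> from above, so one of them is rooted at \<open>\<omega> v\<close>. By fullness of the root it
  contains all edges leaving \<open>\<omega> v\<close>, including those of the other tile, a contradiction.
\<close>

section \<open>Words and generated submonoids\<close>

lemma Nil_in_words: "[] \<in> words p"
  by (simp add: words_def)

lemma append_in_words: "u @ v \<in> words p \<longleftrightarrow> u \<in> words p \<and> v \<in> words p"
  by (auto simp: words_def)

lemma generated_submonoid_eq_concat:
  "generated_submonoid A = concat ` lists A"
proof (intro set_eqI iffI)
  fix w assume "w \<in> generated_submonoid A"
  then show "w \<in> concat ` lists A"
  proof induction
    case one
    show ?case by (rule image_eqI[of _ _ "[]"]) auto
  next
    case (incl a)
    then show ?case by (intro image_eqI[of _ _ "[a]"]) auto
  next
    case (mult u v)
    then obtain us vs where "u = concat us" "us \<in> lists A" "v = concat vs" "vs \<in> lists A"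
      by blast
    then show ?case by (intro image_eqI[of _ _ "us @ vs"]) auto
  qed
next
  fix w assume "w \<in> concat ` lists A"
  then obtain ws where ws: "ws \<in> lists A" "w = concat ws" by blast
  from ws(1) have "concat ws \<in> generated_submonoid A"
    by (induction ws)
      (auto intro: generated_submonoid.one generated_submonoid.mult generated_submonoid.incl)
  with ws(2) show "w \<in> generated_submonoid A" by simp
qed

section \<open>Finite subtrees through the root\<close>

locale rooted_tile =
  fixes p :: nat and S :: "nat list pair_pre_digraph"
  assumes tile: "nontrivial_finite_subtree p S"
    and root: "[] \<in> pverts S"
begin

abbreviation "V \<equiv> pverts S"
abbreviation "L \<equiv> leaves p S"

lemma finite_V: "finite V"
  using tile by (simp add: nontrivial_finite_subtree_def)

lemma vertex_in_words: "v \<in> V \<Longrightarrow> v \<in> words p"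
  using tile
  by (auto simp: nontrivial_finite_subtree_def subtree_def subgraph_def full_tree_def)

lemma arcD:
  assumes "(u, x) \<in> parcs S"
  shows "u \<in> V" "x \<in> V" "\<exists>c<p. x = u @ [c]"
proof -
  have sub: "parcs S \<subseteq> parcs (full_tree p)" and wf: "wf_digraph (with_proj S)"
    using tile by (auto simp: nontrivial_finite_subtree_def subtree_def subgraph_def)
  show "u \<in> V" "x \<in> V"
    using wf_digraph.tail_in_verts[OF wf, of "(u, x)"]
      wf_digraph.head_in_verts[OF wf, of "(u, x)"] assms by auto
  show "\<exists>c<p. x = u @ [c]"
    using sub assms by (auto simp: full_tree_def children_def)
qed

text \<open>
  A walk in \<open>S\<close> from the root to \<open>u c\<close> enters the set of words with prefix \<open>u c\<close>,
  and the edge from \<open>u\<close> to \<open>u c\<close> is the only edge of \<open>T\<^sub>p\<close> between this set and its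
  complement.
\<close>
lemma arc_from_parent:
  assumes "u @ [c] \<in> V"
  shows "(u, u @ [c]) \<in> parcs S"
proof -
  have "reachable (with_proj (mk_symmetric (with_proj S))) [] (u @ [c])"
    using tile assms root
    by (auto simp: nontrivial_finite_subtree_def subtree_def connected_def strongly_connected_def)
  then have walk: "([], u @ [c]) \<in> rtrancl_on V (parcs (mk_symmetric (with_proj S)))"
    by (simp add: reachable_def)
  have "prefix (u @ [c]) x \<longrightarrow> (u, u @ [c]) \<in> parcs S"
    if "([], x) \<in> rtrancl_on V (parcs (mk_symmetric (with_proj S)))" for x
    using that
  proof (induction rule: rtrancl_on_induct)
    case base
    show ?case by simp
  next
    case (step y z)
    then consider "(y, z) \<in> parcs S" | "(z, y) \<in> parcs S"
      by (auto simp: parcs_mk_symmetric)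
    then show ?case
    proof cases
      case 1
      then obtain d where "z = y @ [d]" using arcD(3) by blast
      with 1 step.IH show ?thesis by (auto simp: prefix_snoc)
    next
      case 2
      then obtain d where "y = z @ [d]" using arcD(3) by blast
      with step.IH show ?thesis by (auto simp: prefix_snoc)
    qed
  qed
  from this[OF walk] show ?thesis by simp
qed

lemma arc_iff: "(u, x) \<in> parcs S \<longleftrightarrow> x \<in> V \<and> (\<exists>c. x = u @ [c])"
  using arcD arc_from_parent by blast

lemma prefix_closed: "x @ y \<in> V \<Longrightarrow> x \<in> V"
proof (induction y rule: rev_induct)
  case (snoc c y)
  then have "(x @ y, (x @ y) @ [c]) \<in> parcs S" by (intro arc_from_parent) simp
  then show ?case using arcD(1) snoc.IH by blast
qed simp

lemma nonleaf_iff: "v \<in> V - L \<longleftrightarrow> (\<exists>c. v @ [c] \<in> V)"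
proof
  assume "v \<in> V - L"
  then show "\<exists>c. v @ [c] \<in> V" by (auto simp: leaves_def children_def)
next
  assume "\<exists>c. v @ [c] \<in> V"
  then obtain c where c: "v @ [c] \<in> V" by blast
  then have "c < p" using vertex_in_words by (fastforce simp: words_def)
  with c prefix_closed[OF c] show "v \<in> V - L" by (auto simp: leaves_def children_def)
qed

lemma root_nonleaf: "[] \<in> V - L"
proof -
  have "parcs S \<noteq> {}" using tile by (simp add: nontrivial_finite_subtree_def)
  then obtain u c where "u @ [c] \<in> V" using arc_iff by fastforce
  moreover obtain d y where "u @ [c] = [d] @ y" by (cases u) auto
  ultimately have "[] @ [d] \<in> V" using prefix_closed[of "[d]" y] by simp
  then show ?thesis unfolding nonleaf_iff by blast
qed

lemma leaf_in_V: "l \<in> L \<Longrightarrow> l \<in> V"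
  by (simp add: leaves_def)

text \<open>A vertex strictly below \<open>l\<close> would, by prefix-closure, give \<open>l\<close> a child.\<close>
lemma leaf_prefix_vertex:
  assumes "l \<in> L" "v \<in> V" "prefix l v"
  shows "v = l"
proof (rule ccontr)
  assume "v \<noteq> l"
  with \<open>prefix l v\<close> obtain c y where "v = l @ c # y"
    by (metis append_Nil2 list.exhaust prefixE)
  with \<open>v \<in> V\<close> have "l @ [c] \<in> V" using prefix_closed[of "l @ [c]" y] by simp
  with \<open>l \<in> L\<close> nonleaf_iff show False by blast
qed

text \<open>
  The source of leaves: for a suitable property, a longest vertex satisfying it cannot have a
  child.
\<close>
lemma longest_vertex:
  assumes "x \<in> V" "P x"
  obtains m where "m \<in> V" "P m" "\<And>y. y \<in> V \<Longrightarrow> P y \<Longrightarrow> length y \<le> length m"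
proof -
  let ?A = "{y \<in> V. P y}"
  have "finite ?A" "?A \<noteq> {}" using finite_V assms by auto
  then have "Max (length ` ?A) \<in> length ` ?A" by (intro Max_in) auto
  then obtain m where "m \<in> ?A" "length m = Max (length ` ?A)" by auto
  moreover have "length y \<le> Max (length ` ?A)" if "y \<in> ?A" for y
    using that \<open>finite ?A\<close> by (intro Max_ge) auto
  ultimately have "m \<in> V" "P m" "\<And>y. y \<in> V \<Longrightarrow> P y \<Longrightarrow> length y \<le> length m" by auto
  with that show thesis by blast
qed

lemma leaf_below_vertex:
  assumes "v \<in> V"
  obtains l where "l \<in> L" "prefix v l"
proof -
  obtain m where m: "m \<in> V" "prefix v m"
    and max: "\<And>y. y \<in> V \<Longrightarrow> prefix v y \<Longrightarrow> length y \<le> length m"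
    using longest_vertex[of v "prefix v"] assms by blast
  have "m \<in> L"
  proof (rule ccontr)
    assume "m \<notin> L"
    with m(1) obtain c where "m @ [c] \<in> V" using nonleaf_iff by blast
    from max[OF this] m(2) show False by simp
  qed
  with m(2) that show thesis by blast
qed

section \<open>Fullness, leaf-comparability and factorization\<close>

lemma full_iff: "full p S \<longleftrightarrow> (\<forall>v \<in> V - L. \<forall>c<p. v @ [c] \<in> V)"
  by (auto simp: full_def children_def)

text \<open>
  The required leaf is a longest vertex \<open>m\<close> comparable with the given word: a non-leaf
  vertex that is a proper prefix of the word could be extended by the next letter, and one that
  extends the word has a child by definition.
\<close>
lemma full_imp_leaf_comparable:
  assumes "full p S"
  shows "leaf_comparable p S"
  unfolding leaf_comparable_def
proof
  fix w assume w: "w \<in> words p"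
  obtain m where m: "m \<in> V" "prefix m w \<or> prefix w m"
    and max: "\<And>y. y \<in> V \<Longrightarrow> prefix y w \<or> prefix w y \<Longrightarrow> length y \<le> length m"
    using longest_vertex[of "[]" "\<lambda>x. prefix x w \<or> prefix w x"] root by auto
  have "m \<in> L"
  proof (rule ccontr)
    assume "m \<notin> L"
    with m(1) have nonleaf: "m \<in> V - L" by blast
    show False
    proof (cases "prefix w m")
      case True
      from nonleaf obtain c where "m @ [c] \<in> V" using nonleaf_iff by blast
      from max[OF this] True show False by simp
    next
      case False
      with m(2) obtain c y where y: "w = m @ c # y"
        by (metis append_Nil2 list.exhaust prefixE prefix_order.refl)
      with w have "c < p" by (simp add: words_def)
      with assms nonleaf have "m @ [c] \<in> V" by (auto simp: full_iff)
      from max[OF this] y show False by simp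
    qed
  qed
  with m(2) show "\<exists>l \<in> L. prefix l w \<or> prefix w l" by blast
qed

lemma leaf_comparable_imp_full:
  assumes "leaf_comparable p S"
  shows "full p S"
  unfolding full_iff
proof (intro ballI allI impI)
  fix v c assume v: "v \<in> V - L" and c: "c < p"
  have "v @ [c] \<in> words p"
    using v c vertex_in_words by (auto simp: words_def)
  with assms obtain l where l: "l \<in> L" "prefix l (v @ [c]) \<or> prefix (v @ [c]) l"
    unfolding leaf_comparable_def by blast
  have "\<not> prefix l v" using leaf_prefix_vertex[OF l(1)] v l(1) by blast
  with l(2) have "prefix (v @ [c]) l" by (auto simp: prefix_snoc)
  then show "v @ [c] \<in> V" using leaf_in_V[OF l(1)] prefix_closed by (metis prefixE)
qed

text \<open>
  The first leaf factors of two factorizations are prefixes of one word, hence comparable, hence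
  equal. A factorization without leaf factors cannot equal one that starts with a leaf, since
  that leaf would be a prefix of a non-leaf vertex.
\<close>
lemma factorization_unique:
  assumes "ls \<in> lists L" "ls' \<in> lists L" "s \<in> V - L" "s' \<in> V - L"
    and "concat ls @ s = concat ls' @ s'"
  shows "ls = ls' \<and> s = s'"
  using assms
proof (induction ls arbitrary: ls' rule: list.induct)
  case Nil
  show ?case
  proof (cases ls')
    case (Cons l ms)
    with Nil.prems have "prefix l s" "l \<in> L" "s \<in> V" "s \<notin> L" by auto
    then show ?thesis using leaf_prefix_vertex by blast
  qed (use Nil in simp)
next
  case (Cons l ms)
  show ?case
  proof (cases ls')
    case Nil
    with Cons.prems have "prefix l s'" "l \<in> L" "s' \<in> V" "s' \<notin> L" by auto
    then show ?thesis using leaf_prefix_vertex by blast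
  next
    case (Cons l' ms')
    have eq: "l @ concat ms @ s = l' @ concat ms' @ s'"
      using Cons.prems(5) Cons by simp
    then have "prefix l l' \<or> prefix l' l"
      by (metis prefixI prefix_same_cases)
    moreover have leaves: "l \<in> L" "l' \<in> L" using Cons.prems Cons by auto
    ultimately have "l = l'" using leaf_prefix_vertex leaf_in_V by blast
    with eq have "concat ms @ s = concat ms' @ s'" by simp
    with Cons.IH[of ms'] Cons.prems Cons \<open>l = l'\<close> show ?thesis by auto
  qed
qed

lemma leaf_comparable_imp_factorization:
  assumes "leaf_comparable p S" "w \<in> words p"
  shows "\<exists>ls s. ls \<in> lists L \<and> s \<in> V - L \<and> w = concat ls @ s"
  using assms(2)
proof (induction w rule: length_induct)
  case (1 w)
  show ?case
  proof (cases "w \<in> V - L")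
    case True
    then show ?thesis by (intro exI[of _ "[]"] exI[of _ w]) simp
  next
    case False
    obtain l where l: "l \<in> L" "prefix l w \<or> prefix w l"
      using assms(1) 1(2) by (auto simp: leaf_comparable_def)
    have "prefix l w"
    proof (cases "prefix w l")
      case True
      then have "w \<in> V" using leaf_in_V[OF l(1)] prefix_closed by (metis prefixE)
      with False have "w \<in> L" by blast
      then have "l = w" using leaf_prefix_vertex True leaf_in_V[OF l(1)] by blast
      then show ?thesis by simp
    qed (use l in blast)
    then obtain w' where w': "w = l @ w'" by (auto elim: prefixE)
    \<comment> \<open>The recursion descends because the root is not a leaf.\<close>
    have "l \<noteq> []" using root_nonleaf l(1) by blast
    with w' have "length w' < length w" "w' \<in> words p"
      using 1(2) by (auto simp: append_in_words)
    with 1(1) obtain ls s where "ls \<in> lists L" "s \<in> V - L" "w' = concat ls @ s"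
      by blast
    with w' l(1) show ?thesis by (intro exI[of _ "l # ls"] exI[of _ s]) simp
  qed
qed

lemma leaf_comparable_imp_unique_factorization:
  assumes "leaf_comparable p S"
  shows "unique_factorization p S"
  unfolding unique_factorization_def
proof
  fix w assume "w \<in> words p"
  with assms obtain ls s where "ls \<in> lists L" "s \<in> V - L" "w = concat ls @ s"
    using leaf_comparable_imp_factorization by blast
  then show "\<exists>!x. case x of (ls, s) \<Rightarrow> ls \<in> lists L \<and> s \<in> V - L \<and> w = concat ls @ s"
    using factorization_unique by (intro ex1I[of _ "(ls, s)"]) auto
qed

text \<open>
  The first leaf factor of a word is a prefix of it; a word without leaf factors is itself a
  vertex, and some leaf lies below it.
\<close>
lemma unique_factorization_imp_leaf_comparable:
  assumes "unique_factorization p S"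
  shows "leaf_comparable p S"
  unfolding leaf_comparable_def
proof
  fix w assume "w \<in> words p"
  with assms obtain ls s where f: "ls \<in> lists L" "s \<in> V - L" "w = concat ls @ s"
    unfolding unique_factorization_def by blast
  show "\<exists>l \<in> L. prefix l w \<or> prefix w l"
  proof (cases ls)
    case Nil
    with f leaf_below_vertex[of s] show ?thesis by auto
  next
    case (Cons l ms)
    with f have "l \<in> L" "prefix l w" by auto
    then show ?thesis by blast
  qed
qed

section \<open>Tilings\<close>

lemma translate_vertex_iff:
  "w \<in> pverts (translate \<omega> S) \<longleftrightarrow> (\<exists>s\<in>V. w = \<omega> @ s)"
  by (auto simp: translate_def)

lemma translate_arc_iff:
  "e \<in> parcs (translate \<omega> S) \<longleftrightarrow> (\<exists>s c. s @ [c] \<in> V \<and> e = (\<omega> @ s, \<omega> @ s @ [c]))"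
  by (force simp: translate_def arc_iff)

lemma tiling_cover_arc:
  assumes "tiling p S \<Omega>" "w \<in> words p" "c < p"
  obtains \<omega> s where "\<omega> \<in> \<Omega>" "s @ [c] \<in> V" "w = \<omega> @ s"
proof -
  have "(w, w @ [c]) \<in> parcs (full_tree p)"
    using assms by (auto simp: full_tree_def children_def)
  with assms(1) obtain \<omega> where "\<omega> \<in> \<Omega>" "(w, w @ [c]) \<in> parcs (translate \<omega> S)"
    unfolding tiling_def by blast
  with that show thesis by (auto simp: translate_arc_iff)
qed

lemma tiling_arc_unique:
  assumes "tiling p S \<Omega>" "\<omega> \<in> \<Omega>" "\<omega>' \<in> \<Omega>"
    and "s @ [c] \<in> V" "s' @ [c] \<in> V" "\<omega> @ s = \<omega>' @ s'"
  shows "\<omega> = \<omega>'"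
proof -
  have "(\<omega> @ s, \<omega> @ s @ [c]) \<in> parcs (translate \<omega> S)"
    unfolding translate_arc_iff using assms(4) by blast
  moreover have "(\<omega> @ s, \<omega> @ s @ [c]) \<in> parcs (translate \<omega>' S)"
    unfolding translate_arc_iff using assms(5,6) by (metis append_assoc)
  ultimately show ?thesis using assms(1-3) unfolding tiling_def by blast
qed

text \<open>If neither root were at the common vertex, both tiles would contain the edge entering it.\<close>
lemma tiling_meet_at_root:
  assumes "tiling p S \<Omega>" "\<omega> \<in> \<Omega>" "\<omega>' \<in> \<Omega>" "\<omega> \<noteq> \<omega>'"
    and "s \<in> V" "s' \<in> V" "\<omega> @ s = \<omega>' @ s'"
  shows "s = [] \<or> s' = []"
proof (rule ccontr)
  assume "\<not> ?thesis"
  then obtain t c t' c' where t: "s = t @ [c]" "s' = t' @ [c']"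
    by (metis rev_exhaust)
  then have "c = c'" "\<omega> @ t = \<omega>' @ t'" using assms(7) by auto
  with t assms tiling_arc_unique show False by metis
qed

lemma tiling_root_full:
  assumes "tiling p S \<Omega>" "c < p"
  shows "[c] \<in> V"
  using tiling_cover_arc[OF assms(1) Nil_in_words assms(2)] by (metis append_Nil append_is_Nil_conv)

text \<open>
  The tile \<open>\<omega>'\<close> supplies the child \<open>v d\<close> that the tile \<open>\<omega>\<close> lacks at
  \<open>\<omega> v\<close>; one of the two is rooted there. It cannot be \<open>\<omega>\<close>, whose root would lack
  a child, nor \<open>\<omega>'\<close>, whose full root would share an edge with \<open>\<omega>\<close>.
\<close>
lemma tiling_imp_full:
  assumes "tiling p S \<Omega>"
  shows "full p S"
  unfolding full_iff
proof (intro ballI allI impI)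
  fix v d assume v: "v \<in> V - L" and d: "d < p"
  show "v @ [d] \<in> V"
  proof (rule ccontr)
    assume missing: "v @ [d] \<notin> V"
    from v obtain c where c: "v @ [c] \<in> V" using nonleaf_iff by blast
    then have "c < p" using vertex_in_words by (fastforce simp: words_def)
    obtain \<omega> where \<omega>: "\<omega> \<in> \<Omega>"
      using tiling_cover_arc[OF assms Nil_in_words d] by blast
    then have "\<omega> @ v \<in> words p"
      using assms v vertex_in_words by (auto simp: tiling_def append_in_words)
    then obtain \<omega>' v' where \<omega>': "\<omega>' \<in> \<Omega>" "v' @ [d] \<in> V" "\<omega> @ v = \<omega>' @ v'"
      using tiling_cover_arc[OF assms _ d] by metis
    have "\<omega> \<noteq> \<omega>'" using \<omega>' missing by auto
    then have "v = [] \<or> v' = []"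
      using tiling_meet_at_root[OF assms \<omega> \<omega>'(1)] v \<omega>'(2,3) prefix_closed by blast
    moreover have "v \<noteq> []" using missing tiling_root_full[OF assms d] by auto
    moreover have "v' \<noteq> []"
    proof
      assume "v' = []"
      then have "v' @ [c] \<in> V" using tiling_root_full[OF assms \<open>c < p\<close>] by simp
      with tiling_arc_unique[OF assms \<omega> \<omega>'(1) c] \<omega>'(3) \<open>\<omega> \<noteq> \<omega>'\<close> show False by blast
    qed
    ultimately show False by blast
  qed
qed

lemma full_imp_tiling_generated_submonoid:
  assumes "full p S"
  shows "tiling p S (generated_submonoid L)"
proof -
  note comparable = full_imp_leaf_comparable[OF assms]
  have factor: "\<exists>\<omega>\<in>concat ` lists L. \<exists>s\<in>V - L. w = \<omega> @ s" if "w \<in> words p" for w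
    using leaf_comparable_imp_factorization[OF comparable that] by blast
  show ?thesis
    unfolding tiling_def generated_submonoid_eq_concat
  proof (intro conjI ballI impI)
    show "nontrivial_finite_subtree p S" by (rule tile)
    have "concat ls \<in> words p" if "ls \<in> lists L" for ls
      using that by (induction ls)
        (auto simp: Nil_in_words append_in_words intro: vertex_in_words leaf_in_V)
    then show "concat ` lists L \<subseteq> words p" by blast
  next
    fix w assume "w \<in> pverts (full_tree p)"
    then show "\<exists>\<omega>\<in>concat ` lists L. w \<in> pverts (translate \<omega> S)"
      using factor[of w] unfolding translate_vertex_iff by (auto simp: full_tree_def)
  next
    fix e assume "e \<in> parcs (full_tree p)"
    then obtain w c where e: "e = (w, w @ [c])" "w \<in> words p" "c < p"
      by (auto simp: full_tree_def children_def)
    from factor[OF e(2)] obtain \<omega> s where "\<omega> \<in> concat ` lists L" "s \<in> V - L" "w = \<omega> @ s"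
      by blast
    moreover from this assms e(3) have "s @ [c] \<in> V" by (auto simp: full_iff)
    ultimately show "\<exists>\<omega>\<in>concat ` lists L. e \<in> parcs (translate \<omega> S)"
      unfolding translate_arc_iff e(1) by (metis append_assoc)
  next
    fix \<omega> \<omega>' assume \<omega>: "\<omega> \<in> concat ` lists L" "\<omega>' \<in> concat ` lists L" "\<omega> \<noteq> \<omega>'"
    then obtain ls ls' where ls: "\<omega> = concat ls" "ls \<in> lists L" "\<omega>' = concat ls'" "ls' \<in> lists L"
      by blast
    show "parcs (translate \<omega> S) \<inter> parcs (translate \<omega>' S) = {}"
    proof (rule ccontr)
      assume "\<not> ?thesis"
      then obtain s c s' c' where "s @ [c] \<in> V" "s' @ [c'] \<in> V" "\<omega> @ s = \<omega>' @ s'"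
        by (auto simp: translate_arc_iff)
      with ls factorization_unique[of ls ls' s s'] have "ls = ls'"
        unfolding nonleaf_iff by blast
      with ls \<omega>(3) show False by simp
    qed
  qed
qed

end

section \<open>Characterization of tiles\<close>

theorem theorem2p3:
  fixes p :: nat and S :: "nat list pair_pre_digraph"
  assumes "p \<ge> 2"
    and "nontrivial_finite_subtree p S"
    and "[] \<in> pverts S"
  shows "((\<exists>\<Omega>. tiling p S \<Omega>) \<longleftrightarrow> full p S) \<and>
         (full p S \<longleftrightarrow> leaf_comparable p S) \<and>
         (leaf_comparable p S \<longleftrightarrow> unique_factorization p S) \<and>
         ((\<exists>\<Omega>. tiling p S \<Omega>) \<longrightarrow> tiling p S (generated_submonoid (leaves p S)))"
proof -
  interpret rooted_tile p S
    using assms(2,3) by unfold_locales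
  show ?thesis
    using tiling_imp_full full_imp_tiling_generated_submonoid
      full_imp_leaf_comparable leaf_comparable_imp_full
      leaf_comparable_imp_unique_factorization unique_factorization_imp_leaf_comparable
    by blast
qed

end
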